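(* Let $\alpha,\beta\ge0$ with $\alpha+\beta>0$. The space $\mathcal C$ is a direct sum of two spaces that are invariant under the basic Cartesian product cosine family $\{C_{\mathrm D}(t),\,t\in\mathbb R\}$: $$\mathcal C=\mathcal C^{\mathrm{skew}}_{\alpha,\beta}\oplus\mathcal D^{\mathrm{weks}}_{\alpha,\beta}.$$
   Context: $\mathfrak C[-\infty,\infty]$ is the space of real continuous functions on $\mathbb R$ with finite limits at $\pm\infty$ (supremum norm); $\mathcal C=(\mathfrak C[-\infty,\infty])^2$. $C(t)f(x)=\frac12[f(x+t)+f(x-t)]$ and $C_{\mathrm D}(t)(f_1,f_2)=(C(t)f_1,C(t)f_2)$ on $\mathcal C$. For a function $g$ on $\mathbb R$, $g^e$ and $g^o$ denote its even and odd parts. $$\mathcal C^{\mathrm{skew}}_{\alpha,\beta}=\{(g_1,g_2)\in\mathcal C:\ g_1^e=g_2^e,\ \beta g_1^o=\alpha g_2^o\},$$ $$\mathcal D^{\mathrm{weks}}_{\alpha,\beta}=\{(g_1,g_2)\in\mathcal C:\ g_1^e=-g_2^e,\ \alpha g_1^o=-\beta g_2^o\}.$$ *)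

theory Defs
  imports "HOL-Analysis.Analysis"
begin

text \<open>A continuous function on the line with finite limits at both ends is bounded, so
  these functions form a subset of the library's space of bounded continuous functions,
  from which they inherit the supremum norm.\<close>

definition C_infty :: "(real \<Rightarrow>\<^sub>C real) set" where
  "C_infty = {f. (\<exists>l. (apply_bcontfun f \<longlongrightarrow> l) at_bot) \<and> (\<exists>l. (apply_bcontfun f \<longlongrightarrow> l) at_top)}"

definition C_pair :: "((real \<Rightarrow>\<^sub>C real) \<times> (real \<Rightarrow>\<^sub>C real)) set" where
  "C_pair = C_infty \<times> C_infty"

definition basic_cosine :: "real \<Rightarrow> (real \<Rightarrow>\<^sub>C real) \<Rightarrow> (real \<Rightarrow>\<^sub>C real)" where
  "basic_cosine t f = Bcontfun (\<lambda>x. (f (x + t) + f (x - t)) / 2)"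

lemma apply_basic_cosine [simp]:
  "apply_bcontfun (basic_cosine t f) x = (f (x + t) + f (x - t)) / 2"
proof -
  obtain B where B: "\<And>x. norm (f x) \<le> B"
    using bounded_apply_bcontfun[of f] by (auto simp: bounded_iff)
  have "(\<lambda>x. (f (x + t) + f (x - t)) / 2) \<in> bcontfun"
  proof (rule bcontfun_normI)
    show "continuous_on UNIV (\<lambda>x. (f (x + t) + f (x - t)) / 2)"
      by (intro continuous_intros continuous_on_compose2[OF continuous_on_apply_bcontfun[of UNIV f]]) auto
    show "norm ((f (x + t) + f (x - t)) / 2) \<le> B" for x
      using B[of "x + t"] B[of "x - t"] by simp
  qed
  then show ?thesis
    by (simp add: basic_cosine_def Bcontfun_inverse)
qed

definition product_cosine ::
  "real \<Rightarrow> (real \<Rightarrow>\<^sub>C real) \<times> (real \<Rightarrow>\<^sub>C real) \<Rightarrow> (real \<Rightarrow>\<^sub>C real) \<times> (real \<Rightarrow>\<^sub>C real)" where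
  "product_cosine t = (\<lambda>(f1, f2). (basic_cosine t f1, basic_cosine t f2))"

definition even_part :: "(real \<Rightarrow> real) \<Rightarrow> real \<Rightarrow> real" where
  "even_part g = (\<lambda>x. (g x + g (- x)) / 2)"

definition odd_part :: "(real \<Rightarrow> real) \<Rightarrow> real \<Rightarrow> real" where
  "odd_part g = (\<lambda>x. (g x - g (- x)) / 2)"

definition C_skew :: "real \<Rightarrow> real \<Rightarrow> ((real \<Rightarrow>\<^sub>C real) \<times> (real \<Rightarrow>\<^sub>C real)) set" where
  "C_skew \<alpha> \<beta> = {(g1, g2) \<in> C_pair.
     (\<forall>x. even_part g1 x = even_part g2 x) \<and>
     (\<forall>x. \<beta> * odd_part g1 x = \<alpha> * odd_part g2 x)}"

definition D_weks :: "real \<Rightarrow> real \<Rightarrow> ((real \<Rightarrow>\<^sub>C real) \<times> (real \<Rightarrow>\<^sub>C real)) set" where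
  "D_weks \<alpha> \<beta> = {(g1, g2) \<in> C_pair.
     (\<forall>x. even_part g1 x = - even_part g2 x) \<and>
     (\<forall>x. \<alpha> * odd_part g1 x = - \<beta> * odd_part g2 x)}"

text \<open>Direct sum in the sense of Banach spaces: both summands are closed linear subspaces.\<close>

definition is_direct_sum :: "'a::real_normed_vector set \<Rightarrow> 'a set \<Rightarrow> 'a set \<Rightarrow> bool" where
  "is_direct_sum U V W \<longleftrightarrow>
     subspace V \<and> closed V \<and> subspace W \<and> closed W \<and>
     V \<inter> W = {0} \<and> U = {v + w | v w. v \<in> V \<and> w \<in> W}"

definition cosine_invariant :: "((real \<Rightarrow>\<^sub>C real) \<times> (real \<Rightarrow>\<^sub>C real)) set \<Rightarrow> bool" where
  "cosine_invariant V \<longleftrightarrow> (\<forall>t. product_cosine t ` V \<subseteq> V)"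

end

theory Submission
  imports Defs
begin

text \<open>Both spaces are cut out by a linear relation between the even parts and a linear relation
  between the odd parts of the two components. Such a space is closed, and it is invariant since
  \<open>C(t)\<close> commutes with taking even and odd parts. For the even parts the two relations describe the
  diagonal and the antidiagonal of the plane, for the odd parts they describe the line through
  \<open>(\<alpha>, \<beta>)\<close> and its orthogonal complement; the decomposition is given by the orthogonal
  projections onto these lines.\<close>

lemma subspace_convergent_bcontfun:
  "subspace {f :: 'a::topological_space \<Rightarrow>\<^sub>C 'b::real_normed_vector. \<exists>l. (apply_bcontfun f \<longlongrightarrow> l) F}"
proof (rule subspaceI; (elim CollectE exE)?; rule CollectI)
  show "\<exists>l. (apply_bcontfun (0 :: 'a \<Rightarrow>\<^sub>C 'b) \<longlongrightarrow> l) F"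
    by (auto simp: zero_bcontfun.rep_eq intro: tendsto_const)
next
  fix f g :: "'a \<Rightarrow>\<^sub>C 'b" and l m
  assume "(apply_bcontfun f \<longlongrightarrow> l) F" "(apply_bcontfun g \<longlongrightarrow> m) F"
  then show "\<exists>l. (apply_bcontfun (f + g) \<longlongrightarrow> l) F"
    by (auto simp: plus_bcontfun.rep_eq intro: tendsto_add)
next
  fix f :: "'a \<Rightarrow>\<^sub>C 'b" and c l
  assume "(apply_bcontfun f \<longlongrightarrow> l) F"
  then show "\<exists>l. (apply_bcontfun (c *\<^sub>R f) \<longlongrightarrow> l) F"
    by (auto simp: scaleR_bcontfun.rep_eq intro: tendsto_scaleR[OF tendsto_const])
qed

text \<open>Convergence in the supremum norm is uniform, so the limits along \<open>F\<close> are
  themselves Cauchy; completeness yields their limit, and the two limits may be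
  interchanged.\<close>

lemma closed_convergent_bcontfun:
  assumes "F \<noteq> bot"
  shows "closed {f :: 'a::topological_space \<Rightarrow>\<^sub>C 'b::complete_space. \<exists>l. (apply_bcontfun f \<longlongrightarrow> l) F}"
  unfolding closed_sequential_limits
proof (intro allI impI; elim conjE)
  fix f :: "nat \<Rightarrow> 'a \<Rightarrow>\<^sub>C 'b" and h
  assume "\<forall>n. f n \<in> {f. \<exists>l. (apply_bcontfun f \<longlongrightarrow> l) F}" and lim: "f \<longlonglongrightarrow> h"
  then obtain g where g: "\<And>n. (apply_bcontfun (f n) \<longlongrightarrow> g n) F"
    by simp metis
  \<comment> \<open>The pointwise bound on the distance of values passes to the limit along the
    nontrivial filter \<open>F\<close>.\<close>
  have dist_g: "dist (g m) (g n) \<le> dist (f m) (f n)" for m n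
    by (rule tendsto_upperbound[OF tendsto_dist[OF g g] _ assms]) (simp add: dist_bounded)
  have "Cauchy f"
    using lim by (auto intro: convergent_Cauchy convergentI)
  then have "Cauchy g"
    unfolding Cauchy_def by (meson dist_g le_less_trans)
  then obtain l where "g \<longlonglongrightarrow> l"
    by (auto simp: Cauchy_convergent_iff convergent_def)
  then have "(apply_bcontfun h \<longlongrightarrow> l) F"
    by (rule swap_uniform_limit'[where f = "\<lambda>n. apply_bcontfun (f n)" and S = UNIV, rotated])
      (use g tendsto_bcontfun_uniform_limit[OF lim] in auto)
  then show "h \<in> {f. \<exists>l. (apply_bcontfun f \<longlongrightarrow> l) F}"
    by auto
qed

lemma C_infty_Int:
  "C_infty = {f. \<exists>l. (apply_bcontfun f \<longlongrightarrow> l) at_bot} \<inter> {f. \<exists>l. (apply_bcontfun f \<longlongrightarrow> l) at_top}"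
  by (auto simp: C_infty_def)

lemma subspace_C_infty: "subspace C_infty"
  unfolding C_infty_Int by (intro subspace_inter subspace_convergent_bcontfun)

lemma closed_C_infty: "closed C_infty"
  unfolding C_infty_Int by (intro closed_Int closed_convergent_bcontfun) auto

lemma basic_cosine_in_C_infty:
  assumes "f \<in> C_infty"
  shows "basic_cosine t f \<in> C_infty"
proof -
  obtain l m where l: "(apply_bcontfun f \<longlongrightarrow> l) at_bot" and m: "(apply_bcontfun f \<longlongrightarrow> m) at_top"
    using assms by (auto simp: C_infty_def)
  have top: "filterlim (\<lambda>x. x + s) at_top at_top" for s :: real
    using filterlim_tendsto_add_at_top[OF tendsto_const[of s] filterlim_ident] by (simp add: add.commute)
  \<comment> \<open>Conjugating with \<open>x \<mapsto> - x\<close> turns the shift by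
    \<open>s\<close> into the shift by \<open>- s\<close>.\<close>
  have bot: "filterlim (\<lambda>x. x + s) at_bot at_bot" for s :: real
    using top[of "- s"] unfolding filterlim_at_bot_mirror filterlim_uminus_at_top[symmetric]
    by (simp add: filterlim_uminus_at_bot)
  have shift: "((\<lambda>x. f (x + s)) \<longlongrightarrow> l) at_bot" "((\<lambda>x. f (x + s)) \<longlongrightarrow> m) at_top" for s
    by (rule filterlim_compose[OF l bot] filterlim_compose[OF m top])+
  \<comment> \<open>Writing \<open>x + - t\<close> lets \<open>shift\<close> apply with
    \<open>s = - t\<close>.\<close>
  have "((\<lambda>x. (f (x + t) + f (x + - t)) / 2) \<longlongrightarrow> (l + l) / 2) at_bot"
    "((\<lambda>x. (f (x + t) + f (x + - t)) / 2) \<longlongrightarrow> (m + m) / 2) at_top"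
    by (intro tendsto_intros shift; simp)+
  moreover have "apply_bcontfun (basic_cosine t f) = (\<lambda>x. (f (x + t) + f (x + - t)) / 2)"
    by (simp add: fun_eq_iff)
  ultimately show ?thesis
    by (auto simp: C_infty_def)
qed

text \<open>\<open>even_part\<close> and \<open>odd_part\<close> return bare functions. With
  reflection as an operator, the parts \<open>(g + reflect g) / 2\<close> and
  \<open>(g - reflect g) / 2\<close> can be formed inside the normed space.\<close>

definition reflect :: "(real \<Rightarrow>\<^sub>C real) \<Rightarrow> (real \<Rightarrow>\<^sub>C real)" where
  "reflect f = Bcontfun (\<lambda>x. f (- x))"

lemma apply_reflect [simp]: "apply_bcontfun (reflect f) x = f (- x)"
proof -
  have "continuous_on UNIV (\<lambda>x. f (- x))"
    by (intro continuous_on_compose2[OF continuous_on_apply_bcontfun[of UNIV f]] continuous_intros) auto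
  moreover have "bounded (range (\<lambda>x. f (- x)))"
    by (rule bounded_subset[OF bounded_apply_bcontfun[of f]]) auto
  ultimately show ?thesis
    by (simp add: reflect_def Bcontfun_inverse bcontfun_def)
qed

text \<open>Reflection exchanges the limits at the two ends.\<close>

lemma reflect_in_C_infty:
  assumes "f \<in> C_infty"
  shows "reflect f \<in> C_infty"
  using assms
  by (auto simp: C_infty_def filterlim_at_bot_mirror[where f = "apply_bcontfun f"]
      filterlim_at_top_mirror[where f = "apply_bcontfun f"] apply_reflect[abs_def])

text \<open>A common form for both summands, with homogeneous relations, so that linearity,
  closedness and invariance need only one proof each.\<close>

definition parity_space ::
  "real \<Rightarrow> real \<Rightarrow> real \<Rightarrow> real \<Rightarrow> ((real \<Rightarrow>\<^sub>C real) \<times> (real \<Rightarrow>\<^sub>C real)) set" where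
  "parity_space a b c d = {g \<in> C_pair. \<forall>x.
     a * even_part (fst g) x + b * even_part (snd g) x = 0 \<and>
     c * odd_part (fst g) x + d * odd_part (snd g) x = 0}"

lemma C_skew_eq: "C_skew \<alpha> \<beta> = parity_space 1 (- 1) \<beta> (- \<alpha>)"
  by (auto simp: C_skew_def parity_space_def)

lemma D_weks_eq: "D_weks \<alpha> \<beta> = parity_space 1 1 \<alpha> \<beta>"
  by (auto simp: D_weks_def parity_space_def add_eq_0_iff2)

text \<open>Reflection exchanges the translations by \<open>t\<close> and \<open>- t\<close>, so it
  commutes with their average.\<close>

lemma even_part_basic_cosine:
  "even_part (basic_cosine t f) x = (even_part f (x + t) + even_part f (x - t)) / 2"
  by (simp add: even_part_def minus_diff_commute[of x t] add.commute[of t] add_divide_distrib)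

lemma odd_part_basic_cosine:
  "odd_part (basic_cosine t f) x = (odd_part f (x + t) + odd_part f (x - t)) / 2"
  by (simp add: odd_part_def minus_diff_commute[of x t] add.commute[of t] add_divide_distrib diff_divide_distrib)

lemma even_part_linear:
  "even_part (\<lambda>x. f x + g x) x = even_part f x + even_part g x"
  "even_part (\<lambda>x. f x - g x) x = even_part f x - even_part g x"
  "even_part (\<lambda>x. r * f x) x = r * even_part f x"
  by (simp_all add: even_part_def field_simps)

lemma odd_part_linear:
  "odd_part (\<lambda>x. f x + g x) x = odd_part f x + odd_part g x"
  "odd_part (\<lambda>x. f x - g x) x = odd_part f x - odd_part g x"
  "odd_part (\<lambda>x. r * f x) x = r * odd_part f x"
  by (simp_all add: odd_part_def field_simps)

lemma subspace_parity_space: "subspace (parity_space a b c d)"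
proof (rule subspaceI)
  have sub: "subspace C_pair"
    unfolding C_pair_def by (intro subspace_Times subspace_C_infty)
  show "0 \<in> parity_space a b c d"
    using subspace_0[OF sub] by (simp add: parity_space_def even_part_def odd_part_def)
  fix g h assume g: "g \<in> parity_space a b c d"
  \<comment> \<open>Stated for arbitrary coefficients, to serve both the even and the odd
    relation.\<close>
  have "e * (r * p) + e' * (r * p') = r * (e * p + e' * p')" for e e' r p p' :: real
    by (simp add: algebra_simps)
  then show "r *\<^sub>R g \<in> parity_space a b c d" for r
    using g subspace_scale[OF sub]
    by (simp add: parity_space_def even_part_linear odd_part_linear)
  assume h: "h \<in> parity_space a b c d"
  have "e * (p + q) + e' * (p' + q') = (e * p + e' * p') + (e * q + e' * q')"
    for e e' p q p' q' :: real
    by (simp add: algebra_simps)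
  then show "g + h \<in> parity_space a b c d"
    using g h subspace_add[OF sub]
    by (simp add: parity_space_def even_part_linear odd_part_linear)
qed

text \<open>Evaluation at a point is 1-Lipschitz for the supremum distance.\<close>

lemma continuous_on_bcontfun_eval: "continuous_on S (\<lambda>f :: 'a::topological_space \<Rightarrow>\<^sub>C 'b::metric_space. f x)"
  unfolding continuous_on_iff
  by (metis dist_fun_lt_imp_dist_val_lt)

text \<open>For each \<open>x\<close> the relations equate continuous functions of \<open>g\<close>;
  the space is the intersection of these closed sets with the closed set
  \<open>C_pair\<close>.\<close>

lemma closed_parity_space: "closed (parity_space a b c d)"
proof -
  have ev: "continuous_on UNIV (\<lambda>g :: (real \<Rightarrow>\<^sub>C real) \<times> (real \<Rightarrow>\<^sub>C real). apply_bcontfun (fst g) x)"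
    "continuous_on UNIV (\<lambda>g :: (real \<Rightarrow>\<^sub>C real) \<times> (real \<Rightarrow>\<^sub>C real). apply_bcontfun (snd g) x)" for x
    by (intro continuous_on_compose2[OF continuous_on_bcontfun_eval[of UNIV x]] continuous_intros; simp)+
  have "closed C_pair"
    unfolding C_pair_def by (intro closed_Times closed_C_infty)
  then show ?thesis
    unfolding parity_space_def Collect_conj_eq Collect_all_eq Collect_mem_eq even_part_def odd_part_def
    by (intro closed_Int closed_INT ballI closed_Collect_eq continuous_intros ev)
      auto
qed

lemma cosine_invariant_parity_space: "cosine_invariant (parity_space a b c d)"
proof -
  \<comment> \<open>Used with the values at \<open>x + t\<close> and \<open>x - t\<close>: a
    relation holding at both points holds for the averages.\<close>
  have average: "e * ((p + q) / 2) + e' * ((p' + q') / 2) = 0"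
    if "e * p + e' * p' = 0" "e * q + e' * q' = 0" for e e' p q p' q' :: real
    using that by (simp add: field_simps)
  show ?thesis
    unfolding cosine_invariant_def parity_space_def product_cosine_def C_pair_def
    by (auto simp only: mem_Collect_eq mem_Times_iff fst_conv snd_conv split_beta
        even_part_basic_cosine odd_part_basic_cosine
        intro!: average basic_cosine_in_C_infty)
qed

lemma C_skew_Int_D_weks:
  assumes "\<alpha>\<^sup>2 + \<beta>\<^sup>2 \<noteq> 0"
  shows "C_skew \<alpha> \<beta> \<inter> D_weks \<alpha> \<beta> = {0}"
proof (intro equalityI subsetI)
  fix g assume "g \<in> C_skew \<alpha> \<beta> \<inter> D_weks \<alpha> \<beta>"
  moreover obtain g1 g2 where g_eq: "g = (g1, g2)"
    by (cases g)
  ultimately have even: "even_part g1 x = 0" "even_part g2 x = 0"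
    and odd: "\<beta> * odd_part g1 x = \<alpha> * odd_part g2 x" "\<alpha> * odd_part g1 x = - \<beta> * odd_part g2 x" for x
    by (auto simp: C_skew_def D_weks_def)
  \<comment> \<open>The two odd relations form a homogeneous linear system with determinant
    \<open>\<alpha>\<^sup>2 + \<beta>\<^sup>2\<close>.\<close>
  have "(\<alpha>\<^sup>2 + \<beta>\<^sup>2) * odd_part g1 x = 0" "(\<alpha>\<^sup>2 + \<beta>\<^sup>2) * odd_part g2 x = 0" for x
    using odd[of x] by algebra+
  then have "odd_part g1 x = 0" "odd_part g2 x = 0" for x
    using assms by auto
  moreover have "f x = even_part f x + odd_part f x" for f x
    by (simp add: even_part_def odd_part_def field_simps)
  ultimately have "g1 x = 0" "g2 x = 0" for x
    by (metis add_0 even)+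
  then have "g1 = 0" "g2 = 0"
    by (auto intro!: bcontfun_eqI)
  then show "g \<in> {0}"
    by (simp add: g_eq zero_prod_def)
next
  fix g :: "(real \<Rightarrow>\<^sub>C real) \<times> (real \<Rightarrow>\<^sub>C real)"
  assume "g \<in> {0}"
  then show "g \<in> C_skew \<alpha> \<beta> \<inter> D_weks \<alpha> \<beta>"
    using subspace_0[OF subspace_parity_space] by (simp add: C_skew_eq D_weks_eq)
qed

lemma C_pair_decomposition:
  assumes s: "\<alpha>\<^sup>2 + \<beta>\<^sup>2 \<noteq> 0" and g: "g \<in> C_pair"
  obtains v w where "v \<in> C_skew \<alpha> \<beta>" "w \<in> D_weks \<alpha> \<beta>" "g = v + w"
proof -
  obtain g1 g2 where g_eq: "g = (g1, g2)" and gC: "g1 \<in> C_infty" "g2 \<in> C_infty"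
    using g by (auto simp: C_pair_def)
  \<comment> \<open>The mean of the two even parts, which gives the projection onto the diagonal;
    one factor 1/2 comes from the mean, the other from the even parts.\<close>
  define h where "h = (1/4) *\<^sub>R (g1 + reflect g1 + (g2 + reflect g2))"
  \<comment> \<open>The coefficient of (\<alpha>, \<beta>) in the orthogonal projection of the pair
    of odd parts; the 2 accounts for \<open>g - reflect g\<close> being twice the odd part.\<close>
  define k where "k = (1 / (2 * (\<alpha>\<^sup>2 + \<beta>\<^sup>2))) *\<^sub>R
    (\<alpha> *\<^sub>R (g1 - reflect g1) + \<beta> *\<^sub>R (g2 - reflect g2))"
  have hkC: "h \<in> C_infty" "k \<in> C_infty"
    unfolding h_def k_def
    by (intro subspace_scale[OF subspace_C_infty] subspace_add[OF subspace_C_infty]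
        subspace_diff[OF subspace_C_infty] reflect_in_C_infty gC)+
  have h_parts: "even_part h x = (even_part g1 x + even_part g2 x) / 2" "odd_part h x = 0" for x
    by (simp_all add: h_def even_part_def odd_part_def add_divide_distrib)
  have k_even: "even_part k x = 0" for x
    by (simp add: k_def even_part_def algebra_simps)
  \<comment> \<open>Cleared of the denominator, so that the later use is a polynomial
    identity.\<close>
  have k_odd: "(\<alpha>\<^sup>2 + \<beta>\<^sup>2) * odd_part k x = \<alpha> * odd_part g1 x + \<beta> * odd_part g2 x"
    for x
  proof -
    have "odd_part (reflect f) x = - odd_part f x" for f
      by (simp add: odd_part_def field_simps)
    then have "odd_part k x = 1 / (2 * (\<alpha>\<^sup>2 + \<beta>\<^sup>2)) *
        (\<alpha> * (odd_part g1 x - - odd_part g1 x) + \<beta> * (odd_part g2 x - - odd_part g2 x))"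
      by (simp only: k_def scaleR_bcontfun.rep_eq plus_bcontfun.rep_eq minus_bcontfun.rep_eq
          real_scaleR_def odd_part_linear)
    moreover have "r * (1 / (2 * r) * (\<alpha> * (p - - p) + \<beta> * (q - - q))) = \<alpha> * p + \<beta> * q"
      if "r \<noteq> 0" for p q r :: real
      using that by (simp add: field_simps)
    ultimately show ?thesis
      using s by metis
  qed
  define v where "v = (h + \<alpha> *\<^sub>R k, h + \<beta> *\<^sub>R k)"
  define w where "w = (g1 - (h + \<alpha> *\<^sub>R k), g2 - (h + \<beta> *\<^sub>R k))"
  have "v \<in> C_pair" "w \<in> C_pair"
    unfolding v_def w_def C_pair_def
    by (auto intro!: subspace_scale[OF subspace_C_infty] subspace_add[OF subspace_C_infty]
        subspace_diff[OF subspace_C_infty] gC hkC)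
  then have "v \<in> C_skew \<alpha> \<beta>"
    by (simp add: C_skew_def v_def even_part_linear odd_part_linear h_parts k_even)
  \<comment> \<open>The remainder after projection is orthogonal to (\<alpha>, \<beta>); this is
    \<open>k_odd\<close> rearranged.\<close>
  moreover have "\<alpha> * (odd_part g1 x - \<alpha> * odd_part k x) = - (\<beta> * (odd_part g2 x - \<beta> * odd_part k x))"
    for x
    using k_odd[of x] by algebra
  with \<open>w \<in> C_pair\<close> have "w \<in> D_weks \<alpha> \<beta>"
    by (simp add: D_weks_def w_def even_part_linear odd_part_linear h_parts k_even) (simp add: field_simps)
  moreover have "g = v + w"
    by (simp add: g_eq v_def w_def)
  ultimately show thesis
    by (rule that)
qed

theorem corollary6p3:
  fixes \<alpha> \<beta> :: real
  assumes "\<alpha> \<ge> 0" and "\<beta> \<ge> 0" and "\<alpha> + \<beta> > 0"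
  shows "is_direct_sum C_pair (C_skew \<alpha> \<beta>) (D_weks \<alpha> \<beta>) \<and>
         cosine_invariant (C_skew \<alpha> \<beta>) \<and> cosine_invariant (D_weks \<alpha> \<beta>)"
proof -
  \<comment> \<open>The sum of squares vanishes only for \<alpha> = \<beta> = 0, which contradicts
    the positive sum.\<close>
  have s: "\<alpha>\<^sup>2 + \<beta>\<^sup>2 \<noteq> 0"
    using assms by (auto simp: sum_power2_eq_zero_iff)
  have "subspace C_pair"
    unfolding C_pair_def by (intro subspace_Times subspace_C_infty)
  moreover have "C_skew \<alpha> \<beta> \<subseteq> C_pair" "D_weks \<alpha> \<beta> \<subseteq> C_pair"
    by (auto simp: C_skew_def D_weks_def)
  ultimately have "{v + w | v w. v \<in> C_skew \<alpha> \<beta> \<and> w \<in> D_weks \<alpha> \<beta>} \<subseteq> C_pair"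
    by (blast intro: subspace_add)
  then have "C_pair = {v + w | v w. v \<in> C_skew \<alpha> \<beta> \<and> w \<in> D_weks \<alpha> \<beta>}"
    using C_pair_decomposition[OF s] by blast
  then show ?thesis
    using C_skew_Int_D_weks[OF s]
    by (simp add: is_direct_sum_def C_skew_eq D_weks_eq subspace_parity_space closed_parity_space
        cosine_invariant_parity_space)
qed

end
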